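(* For every positive integer $k$, we have $g(k^2+1)=k$. That is, whenever $k^2+1$ squares with sides parallel to the sides of the unit square $[0,1]^2$ are packed inside $[0,1]^2$ (with pairwise disjoint interiors), the sum of their side lengths is at most $k$, and the value $k$ is attained by some such packing.
   Context: For a positive integer $n$, $g(n)$ denotes the maximum total length of the sides of $n$ squares packed inside a unit square (i.e. contained in the unit square with pairwise disjoint interiors), where the sides of the $n$ squares are required to be parallel to the sides of the unit square. *)

theory Defs
  imports "HOL-Analysis.Analysis"
begin

definition square :: "real \<times> real \<Rightarrow> real \<Rightarrow> (real \<times> real) set" where
  "square c s = {fst c .. fst c + s} \<times> {snd c .. snd c + s}"

text \<open>The \<open>n\<close> squares are indexed by \<open>{..<n}\<close>; \<open>c i\<close> is the lower left corner and \<open>s i\<close> the side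
  length of the \<open>i\<close>-th one. Squares are non-degenerate.\<close>

definition square_packing :: "nat \<Rightarrow> (nat \<Rightarrow> real \<times> real) \<Rightarrow> (nat \<Rightarrow> real) \<Rightarrow> bool" where
  "square_packing n c s \<longleftrightarrow>
     (\<forall>i<n. s i > 0 \<and> square (c i) (s i) \<subseteq> {0..1} \<times> {0..1}) \<and>
     disjoint_family_on (\<lambda>i. interior (square (c i) (s i))) {..<n}"

text \<open>\<open>Greatest\<close> is a definite description: \<open>g n\<close> is unspecified unless the maximum is attained.\<close>

definition g :: "nat \<Rightarrow> real" where
  "g n = (GREATEST t. \<exists>c s. square_packing n c s \<and> t = (\<Sum>i<n. s i))"

end

theory Submission
  imports Defs
begin

text \<open>Scale the unit square to \<open>[0,k]\<^sup>2\<close>, so that the claim becomes \<open>\<Sum>a\<^sub>i \<le> k\<^sup>2\<close> for the new side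
  lengths \<open>a\<^sub>i\<close>, and intersect the squares, taken half-open, with a lattice \<open>(\<delta>, \<epsilon>) + \<int>\<^sup>2\<close>. The \<open>i\<close>-th
  square meets \<open>p\<^sub>i\<close> vertical and \<open>q\<^sub>i\<close> horizontal lattice lines, where \<open>\<bar>p\<^sub>i - q\<^sub>i\<bar> \<le> 1\<close> and hence
  \<open>p\<^sub>i + q\<^sub>i - 1 \<le> p\<^sub>i q\<^sub>i\<close>; by disjointness \<open>\<Sum>p\<^sub>i q\<^sub>i \<le> k\<^sup>2\<close>. If \<open>\<Sum>a\<^sub>i > k\<^sup>2\<close>, then, since
  the average of \<open>\<Sum>p\<^sub>i\<close> over \<open>\<delta>\<close> is \<open>\<Sum>a\<^sub>i\<close>, some \<open>\<delta>\<close> gives \<open>\<Sum>p\<^sub>i \<ge> k\<^sup>2 + 1\<close>, and independently some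
  \<open>\<epsilon>\<close> gives \<open>\<Sum>q\<^sub>i \<ge> k\<^sup>2 + 1\<close>. With \<open>k\<^sup>2 + 1\<close> squares this yields \<open>k\<^sup>2 + 1 \<le> k\<^sup>2\<close>.\<close>

section \<open>Lattice points in half-open intervals\<close>

definition lattice_hits :: "real \<Rightarrow> real \<Rightarrow> real \<Rightarrow> int set" where
  "lattice_hits \<delta> a b = {m. a \<le> of_int m + \<delta> \<and> of_int m + \<delta> < b}"

lemma lattice_hits_eq: "lattice_hits \<delta> a b = {\<lceil>a - \<delta>\<rceil>..<\<lceil>b - \<delta>\<rceil>}"
  unfolding lattice_hits_def by (auto simp: ceiling_le_iff less_ceiling_iff)

lemma finite_lattice_hits [simp]: "finite (lattice_hits \<delta> a b)"
  by (simp add: lattice_hits_eq)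

text \<open>An offset in [0,1) leaves exactly \<open>k\<close> translated integers in [0,k); this is
  where the total of \<open>k\<^sup>2\<close> lattice points comes from.\<close>

lemma lattice_hits_subset:
  assumes "0 \<le> a" "b \<le> real k" "0 \<le> \<delta>" "\<delta> < 1"
  shows "lattice_hits \<delta> a b \<subseteq> {0..<int k}"
proof
  fix m assume "m \<in> lattice_hits \<delta> a b"
  then have "-1 < real_of_int m" "real_of_int m < real k"
    using assms by (auto simp: lattice_hits_def)
  then show "m \<in> {0..<int k}" by auto
qed

text \<open>The claim for the counts \<open>p\<close>, \<open>q\<close> amounts to (p - 1)(q - 1)
  \<ge> 0, which fails only if one count is 0 and the other at least 2. Equal lengths force the
  counts to differ by at most 1, which excludes that.\<close>

lemma card_lattice_hits_add_le:
  assumes "a \<le> b" "b - a = d - c"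
  shows "card (lattice_hits \<delta> a b) + card (lattice_hits \<epsilon> c d)
    \<le> card (lattice_hits \<delta> a b) * card (lattice_hits \<epsilon> c d) + 1"
proof -
  define p q where "p = card (lattice_hits \<delta> a b)" and "q = card (lattice_hits \<epsilon> c d)"
  have "\<lceil>a - \<delta>\<rceil> \<le> \<lceil>b - \<delta>\<rceil>" "\<lceil>c - \<epsilon>\<rceil> \<le> \<lceil>d - \<epsilon>\<rceil>"
    using assms by (auto intro!: ceiling_mono)
  then have pq: "int p = \<lceil>b - \<delta>\<rceil> - \<lceil>a - \<delta>\<rceil>" "int q = \<lceil>d - \<epsilon>\<rceil> - \<lceil>c - \<epsilon>\<rceil>"
    by (auto simp: p_def q_def lattice_hits_eq)
  have "p \<le> q + 1" "q \<le> p + 1"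
    using assms pq by linarith+
  then have "p + q \<le> p * q + 1"
    by (cases p; cases q) auto
  then show ?thesis by (simp add: p_def q_def)
qed

text \<open>A discrete substitute for averaging over the offset: the translates of the integers by
  r/N, for r < N, partition the multiples of 1/N.\<close>

lemma sum_card_lattice_hits_ge:
  assumes "N > 0"
  shows "real N * (b - a) - 1 \<le> (\<Sum>r<N. real (card (lattice_hits (real r / real N) a b)))"
proof -
  let ?H = "\<lambda>r. lattice_hits (real r / real N) a b"
  let ?J = "lattice_hits 0 (real N * a) (real N * b)"
  \<comment> \<open>Division with remainder writes j/N as m + r/N, with \<open>r\<close> selecting
    the translate and \<open>m\<close> the hit in it.\<close>
  let ?f = "\<lambda>j. (nat (j mod int N), j div int N)"
  have "inj_on ?f ?J"
  proof (rule inj_onI)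
    fix i j assume "?f i = ?f j"
    then have "i mod int N = j mod int N" "i div int N = j div int N"
      using assms by (auto simp: eq_nat_nat_iff)
    then show "i = j" by (metis div_mult_mod_eq)
  qed
  moreover have "?f ` ?J \<subseteq> Sigma {..<N} ?H"
  proof
    fix z assume "z \<in> ?f ` ?J"
    then obtain j where j: "real N * a \<le> real_of_int j" "real_of_int j < real N * b" and z: "z = ?f j"
      by (auto simp: lattice_hits_def)
    have "real_of_int j = real N * real_of_int (j div int N) + real_of_int (j mod int N)"
      by (metis mult_div_mod_eq of_int_add of_int_mult of_int_of_nat_eq)
    also have "\<dots> = real N * (real_of_int (j div int N) + real_of_int (j mod int N) / real N)"
      using assms by (simp add: field_simps)
    finally show "z \<in> Sigma {..<N} ?H"
      using j assms by (simp add: z lattice_hits_def nat_less_iff)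
  qed
  ultimately have "card ?J \<le> card (Sigma {..<N} ?H)"
    by (rule card_inj_on_le) simp
  also have "\<dots> = (\<Sum>r<N. card (?H r))" by simp
  finally have "real (card ?J) \<le> (\<Sum>r<N. real (card (?H r)))"
    by (metis of_nat_le_iff of_nat_sum)
  moreover have "real N * (b - a) - 1 \<le> real (card ?J)"
    by (simp add: lattice_hits_eq algebra_simps) linarith
  ultimately show ?thesis by linarith
qed

lemma exists_offset_sum_card_gt:
  fixes a b :: "nat \<Rightarrow> real"
  assumes "real K < (\<Sum>i<n. b i - a i)"
  obtains \<delta> where "0 \<le> \<delta>" "\<delta> < 1" "K < (\<Sum>i<n. card (lattice_hits \<delta> (a i) (b i)))"
proof (rule ccontr)
  assume "\<not> thesis"
  with that have le: "(\<Sum>i<n. card (lattice_hits \<delta> (a i) (b i))) \<le> K" if "0 \<le> \<delta>" "\<delta> < 1" for \<delta>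
    using \<open>0 \<le> \<delta>\<close> \<open>\<delta> < 1\<close> by (meson not_le)
  define S where "S = (\<Sum>i<n. b i - a i)"
  \<comment> \<open>Each of the \<open>n\<close> intervals loses at most 1 in the sum over offsets,
    so \<open>N\<close> is chosen to make the surplus N(S - K) exceed \<open>n\<close>.\<close>
  obtain N :: nat where N: "real n < real N * (S - real K)"
    using reals_Archimedean3[of "S - real K"] assms by (auto simp: S_def)
  then have "N > 0" by (cases N) auto
  have "real N * S - real n = (\<Sum>i<n. real N * (b i - a i) - 1)"
    by (simp add: S_def sum_subtractf sum_distrib_left right_diff_distrib)
  also have "\<dots> \<le> (\<Sum>i<n. \<Sum>r<N. real (card (lattice_hits (real r / real N) (a i) (b i))))"
    by (intro sum_mono sum_card_lattice_hits_ge \<open>N > 0\<close>)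
  also have "\<dots> = (\<Sum>r<N. real (\<Sum>i<n. card (lattice_hits (real r / real N) (a i) (b i))))"
    by (subst sum.swap) simp
  also have "\<dots> \<le> (\<Sum>r<N. real K)"
    by (intro sum_mono of_nat_mono le) auto
  finally show False using N by (simp add: algebra_simps)
qed

lemma interior_square:
  "interior (square c s) = {fst c<..<fst c + s} \<times> {snd c<..<snd c + s}"
  by (simp add: square_def interior_Times)

lemma square_subset_unit_iff:
  assumes "s > 0"
  shows "square c s \<subseteq> {0..1} \<times> {0..1} \<longleftrightarrow>
    0 \<le> fst c \<and> fst c + s \<le> 1 \<and> 0 \<le> snd c \<and> snd c + s \<le> 1"
  using assms by (auto simp: square_def times_subset_iff)

lemma sum_sides_le:
  assumes "k \<ge> 1" and pack: "square_packing (k\<^sup>2 + 1) c s"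
  shows "(\<Sum>i<k\<^sup>2 + 1. s i) \<le> real k"
proof (rule ccontr)
  assume contr: "\<not> ?thesis"
  define n where "n = k\<^sup>2 + 1"
  let ?x = "\<lambda>i. real k * fst (c i)" and ?y = "\<lambda>i. real k * snd (c i)" and ?a = "\<lambda>i. real k * s i"
  have k: "real k > 0" using assms by simp
  have pos: "s i > 0" if "i < n" for i
    using pack that by (auto simp: square_packing_def n_def)
  have bounds: "0 \<le> fst (c i) \<and> fst (c i) + s i \<le> 1 \<and> 0 \<le> snd (c i) \<and> snd (c i) + s i \<le> 1"
    if "i < n" for i
    using pack that by (simp add: square_packing_def n_def flip: square_subset_unit_iff)
  have disj: "interior (square (c i) (s i)) \<inter> interior (square (c j) (s j)) = {}"
    if "i < n" "j < n" "i \<noteq> j" for i j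
    using pack that unfolding square_packing_def disjoint_family_on_def n_def by blast
  have "real (k\<^sup>2) < real k * (\<Sum>i<n. s i)"
    using contr k by (simp add: n_def power2_eq_square del: sum.lessThan_Suc)
  \<comment> \<open>The left ends \<open>z\<close> cancel, so one bound serves both coordinates,
    whose offsets can be chosen independently.\<close>
  then have gt: "real (k\<^sup>2) < (\<Sum>i<n. (z i + ?a i) - z i)" for z
    by (simp add: sum_distrib_left)
  obtain \<delta> where \<delta>: "0 \<le> \<delta>" "\<delta> < 1"
    and p: "k\<^sup>2 < (\<Sum>i<n. card (lattice_hits \<delta> (?x i) (?x i + ?a i)))"
    using exists_offset_sum_card_gt[OF gt] by metis
  obtain \<epsilon> where \<epsilon>: "0 \<le> \<epsilon>" "\<epsilon> < 1"
    and q: "k\<^sup>2 < (\<Sum>i<n. card (lattice_hits \<epsilon> (?y i) (?y i + ?a i)))"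
    using exists_offset_sum_card_gt[OF gt] by metis
  let ?P = "\<lambda>i. lattice_hits \<delta> (?x i) (?x i + ?a i)" and ?Q = "\<lambda>i. lattice_hits \<epsilon> (?y i) (?y i + ?a i)"
  have disjPQ: "(?P i \<times> ?Q i) \<inter> (?P j \<times> ?Q j) = {}" if ij: "i < n" "j < n" "i \<noteq> j" for i j
  proof (rule ccontr)
    assume "\<not> ?thesis"
    then obtain m l where "m \<in> ?P i" "m \<in> ?P j" "l \<in> ?Q i" "l \<in> ?Q j" by auto
    \<comment> \<open>A common lattice point may lie on a left or lower edge, but it is strictly
      below all right and upper ends. So the open squares overlap too, and a point strictly between
      the bounds contradicts disjointness.\<close>
    then have xy: "max (?x i) (?x j) < min (?x i + ?a i) (?x j + ?a j)"
      "max (?y i) (?y j) < min (?y i + ?a i) (?y j + ?a j)"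
      by (auto simp: lattice_hits_def)
    obtain u v where "max (?x i) (?x j) < u" "u < min (?x i + ?a i) (?x j + ?a j)"
      "max (?y i) (?y j) < v" "v < min (?y i + ?a i) (?y j + ?a j)"
      using dense[OF xy(1)] dense[OF xy(2)] by blast
    then have "(u / k, v / k) \<in> interior (square (c i) (s i)) \<inter> interior (square (c j) (s j))"
      using k by (auto simp: interior_square field_simps)
    then show False using disj[OF ij] by blast
  qed
  have "?P i \<times> ?Q i \<subseteq> {0..<int k} \<times> {0..<int k}" if "i < n" for i
  proof (intro Sigma_mono lattice_hits_subset \<delta> \<epsilon>)
    have "real k * (fst (c i) + s i) \<le> real k * 1" "real k * (snd (c i) + s i) \<le> real k * 1"
      using bounds[OF that] by (intro mult_left_mono; simp)+
    then show "?x i + ?a i \<le> real k" "?y i + ?a i \<le> real k"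
      by (simp_all add: algebra_simps)
  qed (use bounds[OF that] in auto)
  then have "card (\<Union>i<n. ?P i \<times> ?Q i) \<le> card ({0..<int k} \<times> {0..<int k})"
    by (intro card_mono) auto
  also have "card (\<Union>i<n. ?P i \<times> ?Q i) = (\<Sum>i<n. card (?P i \<times> ?Q i))"
    using disjPQ by (intro card_UN_disjoint) auto
  finally have "(\<Sum>i<n. card (?P i) * card (?Q i)) \<le> k\<^sup>2"
    by (simp add: card_cartesian_product power2_eq_square)
  \<comment> \<open>The left side is at least 2(k^2 + 1) by the choice of offsets, while the right
    side is at most k^2 + (k^2 + 1).\<close>
  moreover have "(\<Sum>i<n. card (?P i) + card (?Q i)) \<le> (\<Sum>i<n. card (?P i) * card (?Q i) + 1)"
    by (intro sum_mono card_lattice_hits_add_le) (use pos k in \<open>auto simp: less_imp_le\<close>)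
  ultimately show False
    using p q unfolding sum.distrib by (simp add: n_def del: sum.lessThan_Suc)
qed

section \<open>A packing of total side length \<open>k\<close>\<close>

text \<open>The \<open>k \<times> k\<close> grid of cells, with cell \<open>0\<close> replaced by two squares of half its side placed along
  its diagonal.\<close>

definition split_grid_corner :: "nat \<Rightarrow> nat \<Rightarrow> real \<times> real" where
  "split_grid_corner k i =
    (if i = k\<^sup>2 then (1 / (2 * k), 1 / (2 * k)) else (real (i mod k) / k, real (i div k) / k))"

definition split_grid_side :: "nat \<Rightarrow> nat \<Rightarrow> real" where
  "split_grid_side k i = (if i = 0 \<or> i = k\<^sup>2 then 1 / (2 * k) else 1 / k)"

lemma square_packing_split_grid:
  assumes "k \<ge> 1"
  shows "square_packing (k\<^sup>2 + 1) (split_grid_corner k) (split_grid_side k)"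
proof -
  let ?S = "\<lambda>i. square (split_grid_corner k i) (split_grid_side k i)"
  have k: "real k > 0" using assms by simp
  \<comment> \<open>Rounding down the scaled coordinates recovers the grid cell containing the
    point. Index \<open>k\<^sup>2\<close> is identified with 0 because both half-size squares lie in
    cell 0, so only that pair needs a separate check.\<close>
  have cell: "(if i = k\<^sup>2 then 0 else i) = nat \<lfloor>k * u\<rfloor> + k * nat \<lfloor>k * v\<rfloor>"
    if "(u, v) \<in> interior (?S i)" for i and u v :: real
  proof (cases "i = k\<^sup>2")
    case True
    then have "0 < k * u" "k * u < 1" "0 < k * v" "k * v < 1"
      using that k by (auto simp: interior_square split_grid_corner_def split_grid_side_def field_simps)
    then have "\<lfloor>k * u\<rfloor> = 0" "\<lfloor>k * v\<rfloor> = 0" by linarith+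
    then show ?thesis using True by simp
  next
    case False
    then have "real (i mod k) < k * u" "k * u < real (i mod k) + 1"
      "real (i div k) < k * v" "k * v < real (i div k) + 1"
      using that k by (auto simp: interior_square split_grid_corner_def split_grid_side_def field_simps
          split: if_splits)
    then have "\<lfloor>k * u\<rfloor> = int (i mod k)" "\<lfloor>k * v\<rfloor> = int (i div k)" by linarith+
    then show ?thesis using False by simp
  qed
  have halves: "interior (?S 0) \<inter> interior (?S (k\<^sup>2)) = {}"
    using k by (auto simp: interior_square split_grid_corner_def split_grid_side_def)
  have "interior (?S i) \<inter> interior (?S j) = {}" if "i < k\<^sup>2 + 1" "j < k\<^sup>2 + 1" "i \<noteq> j" for i j
  proof (rule ccontr)
    assume ne: "\<not> ?thesis"
    then obtain u v where "(u, v) \<in> interior (?S i)" "(u, v) \<in> interior (?S j)" by auto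
    from this[THEN cell] have "(if i = k\<^sup>2 then 0 else i) = (if j = k\<^sup>2 then 0 else j)"
      by simp
    then have "i = 0 \<and> j = k\<^sup>2 \<or> i = k\<^sup>2 \<and> j = 0"
      using \<open>i \<noteq> j\<close> by (auto split: if_splits)
    then show False using ne halves by blast
  qed
  moreover have "split_grid_side k i > 0 \<and> ?S i \<subseteq> {0..1} \<times> {0..1}" if i: "i < k\<^sup>2 + 1" for i
  proof -
    have pos: "split_grid_side k i > 0" using k by (simp add: split_grid_side_def)
    have side: "split_grid_side k i \<le> 1 / k" using k by (simp add: split_grid_side_def field_simps)
    have "fst (split_grid_corner k i) + split_grid_side k i \<le> 1 \<and>
      snd (split_grid_corner k i) + split_grid_side k i \<le> 1"
    proof (cases "i = k\<^sup>2")
      case True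
      then show ?thesis
        using assms by (simp add: split_grid_corner_def split_grid_side_def field_simps)
    next
      case False
      then have "i mod k < k" "i div k < k"
        using i assms by (auto simp: less_mult_imp_div_less power2_eq_square)
      then have "real (i mod k) + 1 \<le> k" "real (i div k) + 1 \<le> k" by linarith+
      then have "real (i mod k) / k + 1 / k \<le> 1" "real (i div k) / k + 1 / k \<le> 1"
        using k by (auto simp: field_simps)
      then show ?thesis
        using False side by (auto simp: split_grid_corner_def)
    qed
    then show ?thesis
      using pos by (auto simp: square_subset_unit_iff split_grid_corner_def)
  qed
  ultimately show ?thesis
    by (auto simp: square_packing_def disjoint_family_on_def)
qed

lemma sum_split_grid_side:
  assumes "k \<ge> 1"
  shows "(\<Sum>i<k\<^sup>2 + 1. split_grid_side k i) = real k"
proof -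
  \<comment> \<open>\<open>m\<close> counts the undivided cells; the two half-size squares together
    contribute the side of one more cell.\<close>
  obtain m where m: "k\<^sup>2 = Suc m" using assms by (cases "k\<^sup>2") auto
  have "(\<Sum>i<k\<^sup>2 + 1. split_grid_side k i) =
      split_grid_side k 0 + (\<Sum>i<m. split_grid_side k (Suc i)) + split_grid_side k (k\<^sup>2)"
    using sum.lessThan_Suc_shift[of "split_grid_side k" m] by (simp add: m)
  also have "\<dots> = 1 / (2 * k) + (\<Sum>i<m. 1 / k) + 1 / (2 * k)"
    by (simp add: split_grid_side_def m)
  also have "\<dots> = real (k\<^sup>2) / k"
    unfolding m using assms by (simp add: field_simps)
  finally show ?thesis using assms by (simp add: power2_eq_square)
qed

theorem theorem2p1:
  fixes k :: nat
  assumes "k \<ge> 1"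
  shows "g (k\<^sup>2 + 1) = real k
    \<and> (\<forall>c s. square_packing (k\<^sup>2 + 1) c s \<longrightarrow> (\<Sum>i<k\<^sup>2 + 1. s i) \<le> real k)
    \<and> (\<exists>c s. square_packing (k\<^sup>2 + 1) c s \<and> (\<Sum>i<k\<^sup>2 + 1. s i) = real k)"
proof (intro conjI)
  show upper: "\<forall>c s. square_packing (k\<^sup>2 + 1) c s \<longrightarrow> (\<Sum>i<k\<^sup>2 + 1. s i) \<le> real k"
    using sum_sides_le[OF assms] by blast
  show attained: "\<exists>c s. square_packing (k\<^sup>2 + 1) c s \<and> (\<Sum>i<k\<^sup>2 + 1. s i) = real k"
    using square_packing_split_grid[OF assms] sum_split_grid_side[OF assms] by blast
  show "g (k\<^sup>2 + 1) = real k"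
    unfolding g_def
    by (rule Greatest_equality) (use upper attained in \<open>metis+\<close>)
qed

end
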